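(* For every integer $k \ge 5$ there is a constant $c' = c'(k) > 0$, depending only on $k$, such that for every integer $n \ge k$, $$g_k(n) \le h_k(4,n) \le 2^{2^{2^{c' n^{k-4}\log n}}}.$$
   Context: A $k$-uniform hypergraph $H$ consists of a finite vertex set $V$ and a set of edges, each of which is a $k$-element subset of $V$. A set $S \subset V$ induces (spans) exactly those edges of $H$ that are contained in $S$. An independent set of $H$ is a subset of $V$ that contains no edge of $H$. For integers $n \ge k \ge 5$, $g_k(n)$ denotes the minimum integer $N$ such that any $k$-uniform hypergraph on $N$ vertices with the property that every set of $k+1$ vertices induces 0, 2, or 4 edges contains an independent set of size $n$. For integers $n \ge k \ge 5$ and $t \le k$, $h_k(t,n)$ denotes the minimum integer $N$ such that any $k$-uniform hypergraph on $N$ vertices with the property that any set of $k+1$ vertices induces at most $t$ edges contains an independent set of size $n$. *)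

theory Defs
  imports Complex_Main "HOL-Library.Ramsey" "HOL-Library.Countable_Set"
begin

definition uniform_hypergraph :: "nat \<Rightarrow> 'a set \<Rightarrow> 'a set set \<Rightarrow> bool" where
  "uniform_hypergraph k V E \<longleftrightarrow> finite V \<and> E \<subseteq> [V]\<^bsup>k\<^esup>"

definition induced_edges :: "'a set set \<Rightarrow> 'a set \<Rightarrow> 'a set set" where
  "induced_edges E S = {e \<in> E. e \<subseteq> S}"

definition independent_set :: "'a set \<Rightarrow> 'a set set \<Rightarrow> 'a set \<Rightarrow> bool" where
  "independent_set V E I \<longleftrightarrow> I \<subseteq> V \<and> (\<forall>e\<in>E. \<not> e \<subseteq> I)"

text \<open>Every \<open>k\<close>-uniform hypergraph on \<open>N\<close> vertices in which each set of \<open>k + 1\<close> vertices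
  induces a number of edges lying in \<open>A\<close> has an independent set of size \<open>n\<close>.  Vertices are
  natural numbers; since the hypergraphs are finite, this covers all of them up to isomorphism.\<close>

definition forces_independent_set :: "nat \<Rightarrow> nat set \<Rightarrow> nat \<Rightarrow> nat \<Rightarrow> bool" where
  "forces_independent_set k A n N \<longleftrightarrow>
     (\<forall>(V::nat set) E. uniform_hypergraph k V E \<and> card V = N \<and>
        (\<forall>S\<in>[V]\<^bsup>(k + 1)\<^esup>. card (induced_edges E S) \<in> A) \<longrightarrow>
        (\<exists>I. independent_set V E I \<and> card I = n))"

definition g_num :: "nat \<Rightarrow> nat \<Rightarrow> nat" where
  "g_num k n = (LEAST N. forces_independent_set k {0, 2, 4} n N)"

definition h_num :: "nat \<Rightarrow> nat \<Rightarrow> nat \<Rightarrow> nat" where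
  "h_num k t n = (LEAST N. forces_independent_set k {..t} n N)"

text \<open>The minima above are attained: by Ramsey's theorem the sets minimised over are nonempty
  whenever the complete hypergraph on \<open>k + 1\<close> vertices is excluded.\<close>

lemma ex_forces_independent_set:
  assumes "k + 1 \<notin> A"
  shows "\<exists>N. forces_independent_set k A n N"
proof -
  obtain N :: nat where N: "partn_lst {..<N} [k + 1, n] k"
    using ramsey2_full by blast
  have "\<exists>I. independent_set V E I \<and> card I = n"
    if V: "uniform_hypergraph k V E" "card V = N"
      and A: "\<forall>S\<in>[V]\<^bsup>(k + 1)\<^esup>. card (induced_edges E S) \<in> A" for V :: "nat set" and E
  proof -
    have "finite V" and E: "E \<subseteq> [V]\<^bsup>k\<^esup>"
      using V by (auto simp: uniform_hypergraph_def)
    then obtain b where b: "bij_betw b {..<N} V"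
      using V(2) bij_betw_from_nat_into_finite by blast
    define f where "f = (\<lambda>X. if b ` X \<in> E then 0 else 1 :: nat)"
    have "f \<in> [{..<N}]\<^bsup>k\<^esup> \<rightarrow> {..<2}"
      by (auto simp: f_def)
    then obtain i H where i: "i < 2" and H: "H \<in> [{..<N}]\<^bsup>([k + 1, n] ! i)\<^esup>"
      and mono: "f ` [H]\<^bsup>k\<^esup> \<subseteq> {i}"
      using partn_lstE [OF N, of f 2] by (auto simp: numeral_2_eq_2)
    have HN: "H \<subseteq> {..<N}" and cardH: "card H = [k + 1, n] ! i"
      using H by (auto simp: nsets_def)
    have inj: "inj_on b H"
      using b HN by (meson bij_betw_def inj_on_subset)
    have bH: "b ` H \<subseteq> V" "card (b ` H) = [k + 1, n] ! i"
      using b HN cardH inj by (auto simp: bij_betw_def card_image)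
    have colour: "(if e \<in> E then 0 else 1) = i" if "e \<in> [b ` H]\<^bsup>k\<^esup>" for e
    proof -
      obtain X where X: "X \<subseteq> H" "e = b ` X"
        using \<open>e \<in> [b ` H]\<^bsup>k\<^esup>\<close> by (auto simp: nsets_def subset_image_iff)
      have "X \<in> [H]\<^bsup>k\<^esup>"
        using \<open>e \<in> [b ` H]\<^bsup>k\<^esup>\<close> X inj
        by (auto simp: nsets_def card_image inj_on_subset finite_image_iff)
      then show ?thesis
        using mono X by (auto simp: f_def)
    qed
    show ?thesis
    proof (cases "i = 0")
      case True
      then have S: "b ` H \<in> [V]\<^bsup>(k + 1)\<^esup>"
        using bH \<open>finite V\<close> by (auto simp: nsets_def intro: finite_subset)
      have "induced_edges E (b ` H) = [b ` H]\<^bsup>k\<^esup>"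
      proof
        show "induced_edges E (b ` H) \<subseteq> [b ` H]\<^bsup>k\<^esup>"
          using E by (auto simp: induced_edges_def nsets_def)
        show "[b ` H]\<^bsup>k\<^esup> \<subseteq> induced_edges E (b ` H)"
        proof
          fix e assume e: "e \<in> [b ` H]\<^bsup>k\<^esup>"
          then have "e \<in> E"
            using colour [OF e] True by (metis zero_neq_one)
          with e show "e \<in> induced_edges E (b ` H)"
            by (simp add: induced_edges_def nsets_def)
        qed
      qed
      moreover have "card ([b ` H]\<^bsup>k\<^esup>) = k + 1"
        using bH True by simp
      ultimately show ?thesis
        using A S assms by metis
    next
      case False
      then have "i = 1"
        using i by simp
      have "independent_set V E (b ` H)"
        unfolding independent_set_def
      proof (intro conjI ballI notI)
        fix e assume "e \<in> E" "e \<subseteq> b ` H"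
        then have "e \<in> [b ` H]\<^bsup>k\<^esup>"
          using E by (auto simp: nsets_def)
        with colour \<open>e \<in> E\<close> \<open>i = 1\<close> show False
          by force
      qed (use bH in auto)
      then show ?thesis
        using bH \<open>i = 1\<close> by auto
    qed
  qed
  then show ?thesis
    unfolding forces_independent_set_def by blast
qed

end

theory Submission
  imports Defs
begin

text \<open>
  The inequality between \<open>g\<close> and \<open>h\<close> holds because inducing 0, 2 or 4 edges is a special case of
  inducing at most 4.  The upper bound comes from lowering the uniformity twice by the argument of
  Erdos and Rado, at the price of one exponential each time, and then from a greedy argument of
  the Erdos--Hajnal type, which costs only \<open>2\<close> to the power \<open>O(n ^ (k - 4) * log n)\<close>.

  Lowering the uniformity from \<open>r + 1\<close> to \<open>r\<close>: among many vertices there is an end-homogeneous set,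
  in which it depends only on the \<open>r\<close> smallest vertices of an \<open>(r + 1)\<close>-set whether that set is an
  edge.  Such a set carries an \<open>r\<close>-uniform hypergraph \<open>F\<close> of initial segments of edges, and sets
  independent in \<open>F\<close> are independent in the original hypergraph.  What happens to sparseness?  Let
  \<open>T\<close> have \<open>r + 1\<close> vertices and let \<open>z\<close> lie above \<open>T\<close>.  Every \<open>F\<close>-edge \<open>f\<close> inside \<open>T\<close> gives the edge
  \<open>insert z f\<close> inside \<open>insert z T\<close>, and \<open>T\<close> itself is one further edge exactly when its initial
  segment \<open>T - {Max T}\<close> belongs to \<open>F\<close>.  So \<open>T\<close> inherits the bound on the number of edges, and in it
  the initial segment of \<open>T\<close> counts once more than before.  This is why the induction is about a weighted condition
  (\<open>weighted_sparse\<close>), in which each step raises the weight \<open>p\<close> of the initial segment by one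
  (\<open>weighted_sparse_step_down\<close>).

  From \<open>p = 0\<close> in uniformity \<open>k\<close>, two steps lead to \<open>p = 2\<close> in uniformity \<open>k - 2\<close>.  With the bound 4
  on the weighted count, an initial segment that is an edge now excludes two further edges.  One more
  step would leave a hypergraph of uniformity \<open>k - 3\<close> in which a \<open>(k - 4)\<close>-set extends upwards to
  at most one edge, so that a greedy choice in increasing order rejects at most \<open>n ^ (k - 4)\<close>
  vertices before it has accepted \<open>n\<close>.  Performing the third step on a full end-homogeneous set would
  again cost an exponential of too large a power; instead the greedy choice and the third step are
  interleaved (\<open>greedy_independent\<close>).  There, accepting or rejecting a vertex divides the number of
  remaining candidates by at most \<open>n ^ (k - 4) + 2\<close>, and there are at most \<open>n + n ^ (k - 4)\<close> rounds.
\<close>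

section \<open>Weighted sparseness and end-homogeneous sets\<close>

text \<open>
  For \<open>p = 0\<close> this bounds the number of edges that \<open>r + 1\<close> vertices induce.  The weight is
  present because \<open>G\<close> may be what remains after the uniformity has been lowered \<open>p\<close> times, and each time
  an edge is lost from view that was present exactly when the initial segment \<open>T - {Max T}\<close> is.
\<close>
definition weighted_sparse :: "nat \<Rightarrow> nat \<Rightarrow> nat \<Rightarrow> nat set \<Rightarrow> nat set set \<Rightarrow> bool" where
  "weighted_sparse t p r V G \<longleftrightarrow>
     (\<forall>T\<in>[V]\<^bsup>Suc r\<^esup>. card (induced_edges G T) + (if T - {Max T} \<in> G then p else 0) \<le> t)"

text \<open>
  The sets \<open>f\<close> range over \<open>W\<close>, their extensions over a possibly larger set \<open>U\<close>: while a homogeneous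
  set \<open>W\<close> is being built, the candidates for its further elements must already be indistinguishable
  from below.
\<close>
definition end_homogeneous :: "nat \<Rightarrow> nat set set \<Rightarrow> nat set \<Rightarrow> nat set \<Rightarrow> bool" where
  "end_homogeneous r G W U \<longleftrightarrow>
     (\<forall>f\<in>[W]\<^bsup>r\<^esup>. \<forall>x\<in>U. \<forall>y\<in>U. (\<forall>a\<in>f. a < x \<and> a < y) \<longrightarrow> (insert x f \<in> G \<longleftrightarrow> insert y f \<in> G))"

lemma card_nsets_le_power:
  assumes "finite A"
  shows "card ([A]\<^bsup>r\<^esup>) \<le> card A ^ r"
proof (cases "r \<le> card A")
  case True
  then show ?thesis using binomial_le_pow assms by simp
next
  case False
  then show ?thesis using assms by (simp add: binomial_eq_0)
qed

lemma nsets_insert_cases: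
  assumes "f \<in> [insert v W]\<^bsup>Suc r\<^esup>"
  obtains "f \<in> [W]\<^bsup>Suc r\<^esup>" | A where "A \<in> [W]\<^bsup>r\<^esup>" "f = insert v A" "v \<notin> A"
proof (cases "v \<in> f")
  case True
  then have "f - {v} \<in> [W]\<^bsup>r\<^esup>" using assms by (auto simp: nsets_def)
  then show ?thesis using that(2)[of "f - {v}"] True by (simp add: insert_absorb)
next
  case False
  then show ?thesis using that(1) assms by (auto simp: nsets_def)
qed

lemma finite_induced_edges: "finite S \<Longrightarrow> finite (induced_edges E S)"
  by (rule finite_subset[of _ "Pow S"]) (auto simp: induced_edges_def)

text \<open>
  The least candidate \<open>v\<close> joins \<open>W\<close>.  The only new sets to be decided are those with largest element
  \<open>v\<close>, one for each of the at most \<open>N ^ r\<close> sets in \<open>[W]\<^bsup>r\<^esup>\<close>; so there are at most \<open>2 ^ N ^ r\<close> ways in which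
  a later candidate can behave, and a largest class of equal behaviour survives.  The further factor 2
  pays for the removal of \<open>v\<close>.
\<close>
lemma end_homogeneous_extend:
  fixes W S :: "nat set"
  assumes "finite W" "finite S" "\<forall>a\<in>W. \<forall>x\<in>S. a < x"
    and "end_homogeneous (Suc r) G W (W \<union> S)"
    and "card W + j \<le> N" "(2 * 2 ^ (N ^ r)) ^ j \<le> card S"
  shows "\<exists>U\<subseteq>W \<union> S. card U = card W + j \<and> end_homogeneous (Suc r) G U U"
  using assms
proof (induction j arbitrary: W S)
  case 0
  then show ?case
    by (intro exI[of _ W]) (auto simp: end_homogeneous_def)
next
  case (Suc j)
  define M :: nat where "M = 2 ^ (N ^ r)"
  have M: "M \<ge> 1" by (simp add: M_def)
  have cS: "2 * M * (2 * M) ^ j \<le> card S" using Suc.prems(6) by (simp add: M_def)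
  have pos: "(2 * M) ^ j \<ge> 1" using M by simp
  have M1: "M * (2 * M) ^ j \<ge> 1" using M pos by simp
  have "2 * M * (2 * M) ^ j = 2 * (M * (2 * M) ^ j)" by (rule mult.assoc)
  then have "card S \<noteq> 0" using cS M1 by linarith
  then have ne: "S \<noteq> {}" by auto
  define v where "v = Min S"
  have v: "v \<in> S" "\<And>x. x \<in> S \<Longrightarrow> v \<le> x"
    using ne Suc.prems(2) by (auto simp: v_def)
  define S1 where "S1 = S - {v}"
  have fS1: "finite S1" using Suc.prems(2) by (simp add: S1_def)
  have cS1: "M * (2 * M) ^ j \<le> card S1"
    using cS M1 v(1) Suc.prems(2) by (simp add: S1_def mult.assoc)
  have vW: "v \<notin> W" using Suc.prems(3) v(1) by auto
  define trace where "trace = (\<lambda>x. {A \<in> [W]\<^bsup>r\<^esup>. insert x (insert v A) \<in> G})"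
  let ?B = "Pow ([W]\<^bsup>r\<^esup>)"
  have fB: "finite ([W]\<^bsup>r\<^esup>)" using Suc.prems(1) by (simp add: finite_imp_finite_nsets)
  have "\<exists>y\<in>?B. card S1 \<le> card (trace -` {y} \<inter> S1) * card ?B"
    by (rule pigeonhole_card) (use fB fS1 in \<open>auto simp: trace_def\<close>)
  then obtain y where y: "card S1 \<le> card (trace -` {y} \<inter> S1) * card ?B" by blast
  define C where "C = trace -` {y} \<inter> S1"
  have "card ([W]\<^bsup>r\<^esup>) \<le> card W ^ r" by (rule card_nsets_le_power) fact
  also have "\<dots> \<le> N ^ r" using Suc.prems(5) by (intro power_mono) auto
  finally have "card ?B \<le> M" using fB by (simp add: M_def card_Pow)
  then have "card S1 \<le> card C * M" using y C_def
    by (meson le_trans mult_le_mono2)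
  then have "M * (2 * M) ^ j \<le> M * card C" using cS1 by (metis le_trans mult.commute)
  then have cC: "(2 * M) ^ j \<le> card C" using M by simp
  have CS: "C \<subseteq> S" "v \<notin> C" by (auto simp: C_def S1_def)
  have "\<exists>U\<subseteq>insert v W \<union> C. card U = card (insert v W) + j \<and> end_homogeneous (Suc r) G U U"
  proof (rule Suc.IH)
    show "finite C" using CS Suc.prems(2) finite_subset by blast
    show "\<forall>a\<in>insert v W. \<forall>x\<in>C. a < x"
      using CS v Suc.prems(3) by (metis insertE nat_less_le subsetD)
    show "card (insert v W) + j \<le> N" using Suc.prems(1,5) vW by simp
    show "(2 * 2 ^ N ^ r) ^ j \<le> card C" using cC by (simp add: M_def)
    show "end_homogeneous (Suc r) G (insert v W) (insert v W \<union> C)"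
      unfolding end_homogeneous_def
    proof (intro ballI impI)
      fix f x y assume f: "f \<in> [insert v W]\<^bsup>Suc r\<^esup>"
        and x: "x \<in> insert v W \<union> C" and y: "y \<in> insert v W \<union> C"
        and above: "\<forall>a\<in>f. a < x \<and> a < y"
      from f show "insert x f \<in> G \<longleftrightarrow> insert y f \<in> G"
      proof (cases rule: nsets_insert_cases)
        case 1
        moreover have "x \<in> W \<union> S" "y \<in> W \<union> S" using x y v CS by auto
        ultimately show ?thesis using Suc.prems(4) above unfolding end_homogeneous_def by blast
      next
        case (2 A)
        then have "v < x" "v < y" using above by auto
        then have "x \<in> C" "y \<in> C" using x y Suc.prems(3) v(1) by (auto dest: less_asym)
        then have "trace x = trace y" by (auto simp: C_def)
        then have "A \<in> trace x \<longleftrightarrow> A \<in> trace y" by simp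
        then show ?thesis using 2 by (simp add: trace_def)
      qed
    qed
  qed (use Suc.prems in auto)
  then obtain U where "U \<subseteq> insert v W \<union> C" "card U = card (insert v W) + j"
    "end_homogeneous (Suc r) G U U" by blast
  then show ?case using v(1) CS vW Suc.prems(1) by (intro exI[of _ U]) auto
qed

corollary end_homogeneous_subset:
  assumes "finite V" "(2 * 2 ^ (N ^ r)) ^ N \<le> card V"
  shows "\<exists>U\<subseteq>V. card U = N \<and> end_homogeneous (Suc r) G U U"
proof -
  have "end_homogeneous (Suc r) G {} ({} \<union> V)"
    by (simp add: end_homogeneous_def nsets_def)
  then show ?thesis using end_homogeneous_extend[of "{}" V r G N N] assms by simp
qed

section \<open>Lowering the uniformity\<close>

text \<open>
  So many vertices contain, for an \<open>(r + 2)\<close>-uniform hypergraph, an end-homogeneous set of \<open>N\<close> vertices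
  and one more vertex above them.
\<close>
definition step_down_size :: "nat \<Rightarrow> nat \<Rightarrow> nat" where
  "step_down_size r N = (2 * 2 ^ (Suc N ^ r)) ^ Suc N"

text \<open>
  The largest vertex \<open>z\<close> of an end-homogeneous set \<open>U\<close> is the common upper end through which \<open>F\<close> is
  defined.  For \<open>T\<close> below \<open>z\<close> the condition for \<open>insert z T\<close>, whose initial segment is \<open>T\<close>, is the
  source of the condition for \<open>T\<close>: the edge \<open>T\<close> is counted \<open>p\<close> times as a weight and once as an
  induced edge.
\<close>
lemma weighted_sparse_step_down:
  assumes sparse: "weighted_sparse t p (Suc (Suc r)) V G" and "finite V"
    and card: "step_down_size r N \<le> card V"
  shows "\<exists>W F. W \<subseteq> V \<and> card W = N \<and> weighted_sparse t (Suc p) (Suc r) W F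
           \<and> (\<forall>e\<in>[W]\<^bsup>Suc (Suc r)\<^esup>. e \<in> G \<longleftrightarrow> e - {Max e} \<in> F)"
proof -
  obtain U where U: "U \<subseteq> V" "card U = Suc N" and hom: "end_homogeneous (Suc r) G U U"
    using end_homogeneous_subset[OF \<open>finite V\<close> card[unfolded step_down_size_def]] by blast
  have fU: "finite U" using U(2) by (metis card.infinite nat.distinct(1))
  have neU: "U \<noteq> {}" using U(2) by auto
  define z where "z = Max U"
  define W where "W = U - {z}"
  define F where "F = {f \<in> [W]\<^bsup>Suc r\<^esup>. insert z f \<in> G}"
  have z: "z \<in> U" using fU neU by (simp add: z_def)
  have zW: "a < z" if "a \<in> W" for a
    using that fU by (auto simp: W_def z_def intro: le_neq_implies_less)
  have W: "W \<subseteq> U" "z \<notin> W" "card W = N" using U z fU by (auto simp: W_def)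
  have key: "e \<in> G \<longleftrightarrow> e - {Max e} \<in> F" if e: "e \<in> [W]\<^bsup>Suc (Suc r)\<^esup>" for e
  proof -
    have e': "finite e" "e \<subseteq> W" "card e = Suc (Suc r)" using e by (auto simp: nsets_def)
    then have ne: "e \<noteq> {}" by auto
    define m where "m = Max e"
    have m: "m \<in> e" "\<forall>a\<in>e - {m}. a < m"
      using e' ne by (auto simp: m_def intro: le_neq_implies_less)
    have f: "e - {m} \<in> [W]\<^bsup>Suc r\<^esup>" using e' m(1) by (auto simp: nsets_def)
    then have "e - {m} \<in> [U]\<^bsup>Suc r\<^esup>" using W(1) nsets_mono by blast
    moreover have "\<forall>a\<in>e - {m}. a < m \<and> a < z" using m zW e'(2) by auto
    ultimately have "insert m (e - {m}) \<in> G \<longleftrightarrow> insert z (e - {m}) \<in> G"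
      using hom z m(1) e'(2) W(1) unfolding end_homogeneous_def by blast
    then show ?thesis using f m(1) by (simp add: F_def m_def insert_absorb)
  qed
  have "weighted_sparse t (Suc p) (Suc r) W F"
    unfolding weighted_sparse_def
  proof
    fix T assume T: "T \<in> [W]\<^bsup>Suc (Suc r)\<^esup>"
    then have T': "finite T" "T \<subseteq> W" "card T = Suc (Suc r)" by (auto simp: nsets_def)
    have zT: "z \<notin> T" using T'(2) W by auto
    have iT: "insert z T \<in> [V]\<^bsup>Suc (Suc (Suc r))\<^esup>"
      using T' zT z W(1) U(1) by (auto simp: nsets_def)
    have "Max (insert z T) = z"
      using T' zW by (intro Max_eqI) (auto intro: less_imp_le)
    then have top: "insert z T - {Max (insert z T)} = T" using zT by simp
    have bound: "card (induced_edges G (insert z T)) + (if T \<in> G then p else 0) \<le> t"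
      using sparse iT top unfolding weighted_sparse_def by metis
    \<comment> \<open>the induced edges through \<open>z\<close> that come from \<open>F\<close>, and possibly the one that avoids \<open>z\<close>\<close>
    let ?E = "insert z ` induced_edges F T \<union> (if T \<in> G then {T} else {})"
    have inj: "inj_on (insert z) (induced_edges F T)"
    proof (rule inj_onI)
      fix a b assume "a \<in> induced_edges F T" "b \<in> induced_edges F T" and ab: "insert z a = insert z b"
      then have "z \<notin> a" "z \<notin> b" using zT by (auto simp: induced_edges_def)
      then show "a = b" using ab by (metis insert_ident)
    qed
    have "?E \<subseteq> induced_edges G (insert z T)"
      by (auto simp: induced_edges_def F_def)
    then have "card ?E \<le> card (induced_edges G (insert z T))"
      using T'(1) by (intro card_mono) (auto simp: finite_induced_edges)
    moreover have "card ?E = card (induced_edges F T) + (if T \<in> G then 1 else 0)"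
    proof (cases "T \<in> G")
      case True
      have "T \<notin> insert z ` induced_edges F T" using zT by auto
      then show ?thesis using True T'(1) inj by (simp add: card_image finite_induced_edges)
    next
      case False
      then show ?thesis using inj by (simp add: card_image)
    qed
    ultimately show "card (induced_edges F T) + (if T - {Max T} \<in> F then Suc p else 0) \<le> t"
      using bound key[OF T] by (auto split: if_splits)
  qed
  then show ?thesis using W U key by (intro exI[of _ W] exI[of _ F]) auto
qed

section \<open>The greedy choice\<close>

text \<open>
  \<open>I\<close> holds the accepted vertices and \<open>S\<close> the remaining candidates, which lie above \<open>I\<close> and complete
  no \<open>(q + 1)\<close>-subset of \<open>I\<close> to an edge.  \<open>R\<close> holds the \<open>q\<close>-sets that have caused a rejection:
  each of them forms edges with one rejected vertex \<open>u\<close> and every candidate.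

  The least candidate \<open>v\<close> can be accepted after removing all \<open>x\<close> that form an edge with \<open>v\<close> and
  some \<open>q\<close>-subset \<open>A\<close> of \<open>I\<close>.  If this is too expensive because of a single \<open>A\<close>, then \<open>v\<close> is rejected
  and the many \<open>x\<close> belonging to \<open>A\<close> become the new candidates.  No \<open>A\<close> causes two rejections: with
  \<open>u < v\<close> rejected for \<open>A\<close>, the \<open>q + 3\<close> vertices of \<open>A\<close> together with \<open>u\<close>, \<open>v\<close>, \<open>x\<close> would induce
  the edges obtained by adding \<open>{u, v}\<close>, \<open>{u, x}\<close> or \<open>{v, x}\<close> to \<open>A\<close>.  The first of these is the initial
  segment, so the weighted count would be at least \<open>p + 3 > t\<close>.  Hence \<open>j\<close>, which bounds
  the number of acceptances and rejections still to come, decreases in every round.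
\<close>
lemma greedy_independent:
  fixes n q :: nat
  defines "Q \<equiv> n ^ q"
  assumes sparse: "weighted_sparse t p (Suc (Suc q)) V G" and "t \<le> p + 2" "finite V"
    and "finite I" "I \<subseteq> V" "S \<subseteq> V" "card I \<le> n"
    and "\<forall>a\<in>I. \<forall>x\<in>S. a < x"
    and "\<forall>e\<in>[I]\<^bsup>Suc (Suc q)\<^esup>. e \<notin> G"
    and "\<forall>f\<in>[I]\<^bsup>Suc q\<^esup>. \<forall>x\<in>S. insert x f \<notin> G"
    and "R \<subseteq> [I]\<^bsup>q\<^esup>"
    and "\<forall>A\<in>R. \<exists>u\<in>V - A. (\<forall>x\<in>S. u < x \<and> insert x (insert u A) \<in> G)"
    and "(n - card I) + (Q - card R) \<le> j"
    and "(Q + 2) ^ j \<le> card S"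
  shows "\<exists>J\<subseteq>V. card J = n \<and> (\<forall>e\<in>[J]\<^bsup>Suc (Suc q)\<^esup>. e \<notin> G)"
  using assms(5-)
proof (induction j arbitrary: I R S)
  case 0
  then show ?case by (intro exI[of _ I]) auto
next
  case (Suc j)
  note IH = Suc.IH and pr = Suc.prems
  show ?case
  proof (cases "card I = n")
    case True
    then show ?thesis using pr by (intro exI[of _ I]) auto
  next
    case False
    then have In: "card I < n" using pr by simp
    have fS: "finite S" using pr \<open>finite V\<close> finite_subset by blast
    have pos: "(Q + 2) ^ j \<ge> 1" by simp
    \<comment> \<open>one share for each possible \<open>A\<close>, one share that survives, and one from which \<open>v\<close> is taken\<close>
    have cS: "Q * (Q + 2) ^ j + 2 * (Q + 2) ^ j \<le> card S" using pr(11) by (simp add: algebra_simps)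
    then have "S \<noteq> {}" using pos by auto
    define v where "v = Min S"
    have v: "v \<in> S" "\<And>x. x \<in> S \<Longrightarrow> v \<le> x"
      using \<open>S \<noteq> {}\<close> fS by (auto simp: v_def)
    define S1 where "S1 = S - {v}"
    have S1: "S1 \<subseteq> S" "finite S1" "card S1 = card S - 1" using fS v(1) by (auto simp: S1_def)
    have vS1: "v < x" if "x \<in> S1" for x
      using v(2)[of x] that by (auto simp: S1_def intro: le_neq_implies_less)
    have vI: "v \<notin> I" and vV: "v \<in> V" using pr(5,3) v(1) by auto
    define B where "B = (\<lambda>A. {x \<in> S1. insert x (insert v A) \<in> G})"
    have fR: "finite ([I]\<^bsup>q\<^esup>)" using pr(1) by (simp add: finite_imp_finite_nsets)
    have cR: "card ([I]\<^bsup>q\<^esup>) \<le> Q"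
      using card_nsets_le_power[OF pr(1), of q] power_mono[of "card I" n q] In
      by (simp add: Q_def)
    show ?thesis
    \<comment> \<open>reject \<open>v\<close> if a single \<open>A\<close> would remove a whole share of the candidates\<close>
    proof (cases "\<exists>A\<in>[I]\<^bsup>q\<^esup>. (Q + 2) ^ j \<le> card (B A)")
      case True
      then obtain A where A: "A \<in> [I]\<^bsup>q\<^esup>" and cB: "(Q + 2) ^ j \<le> card (B A)" by blast
      have A': "finite A" "A \<subseteq> I" "card A = q" using A by (auto simp: nsets_def)
      have BS: "B A \<subseteq> S1" by (auto simp: B_def)
      have "A \<notin> R"
      proof
        assume "A \<in> R"
        then obtain u where u: "u \<in> V - A" "\<forall>x\<in>S. u < x \<and> insert x (insert u A) \<in> G"
          using pr(9) by blast
        have "B A \<noteq> {}" using cB pos by auto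
        then obtain x where x: "x \<in> S1" "insert x (insert v A) \<in> G" by (auto simp: B_def)
        have lt: "u < v" "v < x" "u < x" using u(2) v(1) vS1 x(1) S1(1) by auto
        have Alt: "a < v" "a < x" if "a \<in> A" for a
          using that A'(2) pr(5) v(1) x(1) S1(1) by (blast, blast)
        let ?T = "insert x (insert v (insert u A))"
        have ni: "u \<notin> A" "v \<notin> A" "x \<notin> A" using u(1) Alt by auto
        have "?T \<in> [V]\<^bsup>Suc (Suc (Suc q))\<^esup>"
          using A' ni lt u(1) vV x(1) S1(1) pr(2,3) by (auto simp: nsets_def)
        then have bound: "card (induced_edges G ?T) + (if ?T - {Max ?T} \<in> G then p else 0) \<le> t"
          using sparse unfolding weighted_sparse_def by blast
        have "Max ?T = x" using A'(1) lt Alt by (intro Max_eqI) (auto intro: less_imp_le)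
        then have "?T - {Max ?T} = insert v (insert u A)" using ni lt by auto
        moreover have vu: "insert v (insert u A) \<in> G" using u(2) v(1) by blast
        ultimately have bound': "card (induced_edges G ?T) + p \<le> t" using bound by simp
        have xu: "insert x (insert u A) \<in> G" using u(2) x(1) S1(1) by blast
        let ?E = "{insert v (insert u A), insert x (insert v A), insert x (insert u A)}"
        have "?E \<subseteq> induced_edges G ?T" using vu xu x(2) by (auto simp: induced_edges_def)
        moreover have "finite (induced_edges G ?T)"
          using A'(1) by (simp add: finite_induced_edges)
        ultimately have "card ?E \<le> card (induced_edges G ?T)" by (intro card_mono)
        moreover have "insert v (insert u A) \<noteq> insert x (insert v A)"
          "insert v (insert u A) \<noteq> insert x (insert u A)"
          "insert x (insert v A) \<noteq> insert x (insert u A)"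
          using ni lt by (blast dest: less_imp_neq)+
        then have "card ?E = 3" by simp
        ultimately show False using bound' \<open>t \<le> p + 2\<close> by simp
      qed
      have subR: "insert A R \<subseteq> [I]\<^bsup>q\<^esup>" using A pr(8) by simp
      have cAR: "card (insert A R) = Suc (card R)"
        using \<open>A \<notin> R\<close> pr(8) fR finite_subset by (metis card_insert_disjoint)
      have "Suc (card R) \<le> Q" using card_mono[OF fR subR] cR cAR by simp
      then have meas: "(n - card I) + (Q - card (insert A R)) \<le> j" using pr(10) cAR by simp
      show ?thesis
      proof (rule IH[of I "B A" "insert A R"])
        show "\<forall>A'\<in>insert A R. \<exists>u\<in>V - A'. \<forall>x\<in>B A. u < x \<and> insert x (insert u A') \<in> G"
        proof
          fix A' assume "A' \<in> insert A R"
          then consider "A' = A" | "A' \<in> R" by blast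
          then show "\<exists>u\<in>V - A'. \<forall>x\<in>B A. u < x \<and> insert x (insert u A') \<in> G"
          proof cases
            case 1
            then show ?thesis using vV vI A'(2) vS1 by (intro bexI[of _ v]) (auto simp: B_def)
          next
            case 2
            then obtain u where "u \<in> V - A'" "\<forall>x\<in>S. u < x \<and> insert x (insert u A') \<in> G"
              using pr(9) by blast
            moreover have "B A \<subseteq> S" using BS S1(1) by (rule subset_trans)
            ultimately show ?thesis by (intro bexI[of _ u]) auto
          qed
        qed
        show "finite I" "I \<subseteq> V" "B A \<subseteq> V" "card I \<le> n" "\<forall>e\<in>[I]\<^bsup>Suc (Suc q)\<^esup>. e \<notin> G"
          using pr(1,2,3,4,6) BS S1(1) by auto
        show "\<forall>a\<in>I. \<forall>x\<in>B A. a < x" "\<forall>f\<in>[I]\<^bsup>Suc q\<^esup>. \<forall>x\<in>B A. insert x f \<notin> G"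
          using pr(5,7) BS S1(1) by (blast, blast)
      qed (fact subR meas cB)+
    next
      case False
      then have small: "card (B A) \<le> (Q + 2) ^ j" if "A \<in> [I]\<^bsup>q\<^esup>" for A using that
        by (meson linear)
      define S2 where "S2 = S1 - (\<Union>A\<in>[I]\<^bsup>q\<^esup>. B A)"
      have "card (\<Union>A\<in>[I]\<^bsup>q\<^esup>. B A) \<le> (\<Sum>A\<in>[I]\<^bsup>q\<^esup>. card (B A))"
        by (rule card_UN_le[OF fR])
      also have "\<dots> \<le> card ([I]\<^bsup>q\<^esup>) * (Q + 2) ^ j"
        using sum_bounded_above[of "[I]\<^bsup>q\<^esup>" "\<lambda>A. card (B A)" "(Q + 2) ^ j"] small by simp
      also have "\<dots> \<le> Q * (Q + 2) ^ j" using cR by (rule mult_le_mono1)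
      finally have "card (\<Union>A\<in>[I]\<^bsup>q\<^esup>. B A) \<le> Q * (Q + 2) ^ j" .
      moreover have "card S2 \<ge> card S1 - card (\<Union>A\<in>[I]\<^bsup>q\<^esup>. B A)"
        unfolding S2_def by (rule diff_card_le_card_Diff)
          (use S1(2) fR in \<open>auto simp: B_def\<close>)
      ultimately have cS2: "(Q + 2) ^ j \<le> card S2" using cS S1(3) pos by linarith
      have S2: "S2 \<subseteq> S1" "S2 \<subseteq> S" using S1(1) by (auto simp: S2_def)
      have cvI: "card (insert v I) = Suc (card I)" using vI pr(1) by simp
      have meas: "(n - card (insert v I)) + (Q - card R) \<le> j" using pr(10) cvI In by simp
      have mono: "[I]\<^bsup>q\<^esup> \<subseteq> [insert v I]\<^bsup>q\<^esup>" by (rule nsets_mono) auto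
      show ?thesis
      proof (rule IH[of "insert v I" S2 R])
        show "finite (insert v I)" "insert v I \<subseteq> V" "card (insert v I) \<le> n" "S2 \<subseteq> V"
          using pr vV cvI In S2 by auto
        show "\<forall>a\<in>insert v I. \<forall>x\<in>S2. a < x" using pr(5) vS1 S2 by blast
        show "\<forall>e\<in>[insert v I]\<^bsup>Suc (Suc q)\<^esup>. e \<notin> G"
        proof
          fix e assume "e \<in> [insert v I]\<^bsup>Suc (Suc q)\<^esup>"
          then show "e \<notin> G"
            by (cases rule: nsets_insert_cases) (use pr(6,7) v(1) in blast)+
        qed
        show "\<forall>f\<in>[insert v I]\<^bsup>Suc q\<^esup>. \<forall>x\<in>S2. insert x f \<notin> G"
        proof (intro ballI)
          fix f x assume f: "f \<in> [insert v I]\<^bsup>Suc q\<^esup>" and x: "x \<in> S2"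
          from f show "insert x f \<notin> G"
          proof (cases rule: nsets_insert_cases)
            case 1
            then show ?thesis using pr(7) x S2 by blast
          next
            case (2 A)
            then show ?thesis using x by (auto simp: S2_def B_def)
          qed
        qed
        show "R \<subseteq> [insert v I]\<^bsup>q\<^esup>" using pr(8) mono by blast
        show "\<forall>A\<in>R. \<exists>u\<in>V - A. \<forall>x\<in>S2. u < x \<and> insert x (insert u A) \<in> G"
        proof
          fix A assume "A \<in> R"
          then obtain u where "u \<in> V - A" "\<forall>x\<in>S. u < x \<and> insert x (insert u A) \<in> G"
            using pr(9) by blast
          then show "\<exists>u\<in>V - A. \<forall>x\<in>S2. u < x \<and> insert x (insert u A) \<in> G"
            using S2(2) by (intro bexI[of _ u]) auto
        qed
      qed (use meas cS2 in auto)
    qed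
  qed
qed

corollary weighted_sparse_independent:
  assumes "weighted_sparse t p (Suc (Suc q)) V G" "t \<le> p + 2" "finite V"
    and "(n ^ q + 2) ^ (n + n ^ q) \<le> card V"
  shows "\<exists>J\<subseteq>V. card J = n \<and> (\<forall>e\<in>[J]\<^bsup>Suc (Suc q)\<^esup>. e \<notin> G)"
  by (rule greedy_independent[OF assms(1-3), of "{}" V n "{}" "n + n ^ q"])
    (use assms(4) in \<open>auto simp: nsets_def\<close>)

section \<open>Assembling the steps\<close>

lemma independent_pull_back:
  assumes key: "\<forall>e\<in>[W]\<^bsup>Suc r\<^esup>. e \<in> G \<longleftrightarrow> e - {Max e} \<in> F"
    and "J \<subseteq> W" and indep: "\<forall>f\<in>[J]\<^bsup>r\<^esup>. f \<notin> F"
  shows "\<forall>e\<in>[J]\<^bsup>Suc r\<^esup>. e \<notin> G"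
proof
  fix e assume e: "e \<in> [J]\<^bsup>Suc r\<^esup>"
  then have e': "finite e" "e \<subseteq> J" "card e = Suc r" by (auto simp: nsets_def)
  then have "Max e \<in> e" by (intro Max_in) auto
  then have "e - {Max e} \<in> [J]\<^bsup>r\<^esup>" using e' by (auto simp: nsets_def)
  then show "e \<notin> G" using key indep e \<open>J \<subseteq> W\<close> nsets_mono by blast
qed

lemma forces_independent_set_four:
  "forces_independent_set (q + 4) {..4} n
     (step_down_size (q + 2) (step_down_size (q + 1) ((n ^ q + 2) ^ (n + n ^ q))))"
  unfolding forces_independent_set_def
proof (intro allI impI, elim conjE)
  fix V :: "nat set" and E
  define N2 where "N2 = (n ^ q + 2) ^ (n + n ^ q)"
  assume H: "uniform_hypergraph (q + 4) V E"
    and cV: "card V = step_down_size (q + 2) (step_down_size (q + 1) ((n ^ q + 2) ^ (n + n ^ q)))"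
    and A: "\<forall>S\<in>[V]\<^bsup>(q + 4 + 1)\<^esup>. card (induced_edges E S) \<in> {..4}"
  have fV: "finite V" and E: "E \<subseteq> [V]\<^bsup>(q + 4)\<^esup>" using H by (auto simp: uniform_hypergraph_def)
  have sz: "q + 4 = Suc (Suc (Suc (Suc q)))" by simp
  have ws: "weighted_sparse 4 0 (Suc (Suc (Suc (Suc q)))) V E"
    using A by (simp add: weighted_sparse_def eval_nat_numeral)
  obtain W F where W: "W \<subseteq> V" "card W = step_down_size (Suc q) N2"
    "weighted_sparse 4 (Suc 0) (Suc (Suc (Suc q))) W F"
    "\<forall>e\<in>[W]\<^bsup>Suc (Suc (Suc (Suc q)))\<^esup>. e \<in> E \<longleftrightarrow> e - {Max e} \<in> F"
    using weighted_sparse_step_down[OF ws fV, of "step_down_size (Suc q) N2"] cV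
    by (auto simp: N2_def)
  have fW: "finite W" using W(1) fV finite_subset by blast
  obtain X D where X: "X \<subseteq> W" "card X = N2" "weighted_sparse 4 (Suc (Suc 0)) (Suc (Suc q)) X D"
    "\<forall>e\<in>[X]\<^bsup>Suc (Suc (Suc q))\<^esup>. e \<in> F \<longleftrightarrow> e - {Max e} \<in> D"
    using weighted_sparse_step_down[OF W(3) fW, of N2] W(2) by auto
  have fX: "finite X" using X(1) fW finite_subset by blast
  obtain J where J: "J \<subseteq> X" "card J = n" "\<forall>e\<in>[J]\<^bsup>Suc (Suc q)\<^esup>. e \<notin> D"
    using weighted_sparse_independent[OF X(3) _ fX, of n] X(2) by (auto simp: N2_def)
  have "\<forall>e\<in>[J]\<^bsup>Suc (Suc (Suc q))\<^esup>. e \<notin> F" by (rule independent_pull_back[OF X(4) J(1,3)])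
  then have J4: "\<forall>e\<in>[J]\<^bsup>Suc (Suc (Suc (Suc q)))\<^esup>. e \<notin> E"
    using independent_pull_back[OF W(4)] J(1) X(1) by blast
  have "independent_set V E J"
    unfolding independent_set_def
  proof (intro conjI ballI notI)
    show "J \<subseteq> V" using J(1) X(1) W(1) by blast
    fix e assume "e \<in> E" "e \<subseteq> J"
    then have "e \<in> [J]\<^bsup>Suc (Suc (Suc (Suc q)))\<^esup>" using E sz by (auto simp: nsets_def)
    then show False using J4 \<open>e \<in> E\<close> by blast
  qed
  then show "\<exists>I. independent_set V E I \<and> card I = n" using J(2) by blast
qed

section \<open>Size estimates\<close>

lemma step_down_size_eq: "step_down_size r N = 2 ^ (Suc (Suc N ^ r) * Suc N)"
  unfolding step_down_size_def power_mult by simp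

text \<open>
  The power of \<open>N\<close> in the exponent is generous.  Only its independence of \<open>N\<close> matters, since one
  exponential further up a constant power becomes a constant factor.
\<close>
lemma step_down_size_le:
  assumes "2 \<le> N"
  shows "step_down_size r N \<le> 2 ^ (N ^ (2 * r + 4))"
proof -
  have s: "Suc N \<le> N ^ 2"
  proof -
    have "Suc N \<le> N * 2" using assms by simp
    also have "\<dots> \<le> N * N" using assms by (intro mult_le_mono2)
    finally show ?thesis by (simp add: power2_eq_square)
  qed
  have "Suc (Suc N ^ r) * Suc N \<le> Suc N ^ (r + 2)"
  proof -
    have "1 \<le> Suc N ^ r" by simp
    then have "Suc (Suc N ^ r) \<le> 2 * Suc N ^ r" by linarith
    also have "\<dots> \<le> Suc N * Suc N ^ r" using assms by (intro mult_le_mono1) simp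
    finally have "Suc (Suc N ^ r) * Suc N \<le> Suc N * Suc N ^ r * Suc N"
      by (rule mult_le_mono1)
    then show ?thesis by (simp add: algebra_simps)
  qed
  also have "\<dots> \<le> (N ^ 2) ^ (r + 2)" using s by (rule power_mono) simp
  also have "\<dots> = N ^ (2 * (r + 2))" by (rule power_mult[symmetric])
  also have "2 * (r + 2) = 2 * r + 4" by simp
  finally have le: "Suc (Suc N ^ r) * Suc N \<le> N ^ (2 * r + 4)" .
  have "step_down_size r N = 2 ^ (Suc (Suc N ^ r) * Suc N)" by (rule step_down_size_eq)
  also have "\<dots> \<le> 2 ^ (N ^ (2 * r + 4))" using le by (intro power_increasing) auto
  finally show ?thesis .
qed

lemma step_down_size_mono: "N \<le> N' \<Longrightarrow> step_down_size r N \<le> step_down_size r N'"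
  unfolding step_down_size_eq by (intro power_increasing mult_le_mono Suc_le_mono[THEN iffD2] power_mono) auto

lemma step_down_size_twice_le:
  assumes "2 \<le> N"
  shows "step_down_size (q + 2) (step_down_size (q + 1) N) \<le> 2 ^ (2 ^ (N ^ (4 * q + 14)))"
proof -
  have exponent: "2 * (q + 2) + 4 = 2 * q + 8" by simp
  define M where "M = N ^ (2 * q + 6)"
  have M: "M \<ge> 1" using assms by (simp add: M_def)
  have "step_down_size (q + 1) N \<le> 2 ^ M"
    using step_down_size_le[OF assms, of "q + 1"] by (simp add: M_def algebra_simps)
  then have "step_down_size (q + 2) (step_down_size (q + 1) N) \<le> step_down_size (q + 2) (2 ^ M)"
    by (rule step_down_size_mono)
  also have "\<dots> \<le> 2 ^ ((2 ^ M) ^ (2 * (q + 2) + 4))"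
    by (rule step_down_size_le) (use M power_increasing[of 1 M "2::nat"] in simp)
  also have "\<dots> = 2 ^ (2 ^ (M * (2 * q + 8)))"
    unfolding exponent power_mult ..
  also have "\<dots> \<le> 2 ^ (2 ^ (N ^ (4 * q + 14)))"
  proof (intro power_increasing)
    have "2 * q + 8 \<le> 2 ^ (2 * q + 8)" using less_exp[of "2 * q + 8"] by simp
    also have "\<dots> \<le> N ^ (2 * q + 8)" using assms by (rule power_mono) simp
    finally have "M * (2 * q + 8) \<le> M * N ^ (2 * q + 8)" by (rule mult_le_mono2)
    also have "\<dots> = N ^ (4 * q + 14)" by (simp add: M_def flip: power_add)
    finally show "M * (2 * q + 8) \<le> N ^ (4 * q + 14)" .
  qed auto
  finally show ?thesis .
qed

text \<open>
  \<open>n ^ q + 2\<close> is at most \<open>n ^ (q + 2)\<close>, which turns the number of greedy rounds into an exponent of the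
  form \<open>n ^ q * ln n\<close>.  The passage from base \<open>exp 1\<close> to base 2 costs a factor \<open>1 / ln 2\<close>, which is
  estimated by 2.
\<close>
lemma greedy_size_le:
  fixes n q :: nat
  assumes "2 \<le> n" "1 \<le> q"
  shows "real ((n ^ q + 2) ^ (n + n ^ q)) \<le> 2 powr (4 * (q + 2) * real n ^ q * ln (real n))"
proof -
  have n: "real n > 0" "ln (real n) \<ge> 0" using assms by auto
  have a: "n ^ q + 2 \<le> n ^ (q + 2)"
  proof -
    have "2 \<le> n ^ q" using assms self_le_power[of n q] by linarith
    then have "n ^ q + 2 \<le> 2 * 2 * n ^ q" by linarith
    also have "\<dots> \<le> n * n * n ^ q" using assms by (intro mult_le_mono) auto
    finally show ?thesis by simp
  qed
  have b: "n + n ^ q \<le> 2 * n ^ q" using assms self_le_power[of n q] by simp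
  have "(n ^ q + 2) ^ (n + n ^ q) \<le> (n ^ (q + 2)) ^ (n + n ^ q)" by (rule power_mono[OF a]) simp
  also have "\<dots> \<le> (n ^ (q + 2)) ^ (2 * n ^ q)" by (rule power_increasing[OF b]) (use assms in simp)
  also have "\<dots> = n ^ ((q + 2) * (2 * n ^ q))" by (rule power_mult[symmetric])
  finally have "real ((n ^ q + 2) ^ (n + n ^ q)) \<le> real (n ^ ((q + 2) * (2 * n ^ q)))"
    by (rule of_nat_mono)
  also have "\<dots> = exp (real ((q + 2) * (2 * n ^ q)) * ln (real n))"
    unfolding exp_of_nat_mult exp_ln[OF n(1)] by (rule of_nat_power)
  also have "\<dots> \<le> exp ((4 * (q + 2) * real n ^ q * ln (real n)) * ln 2)"
  proof -
    have "1 / 2 \<le> ln (2::real)" by (subst ln_ge_iff) (use exp_half_le2 in auto)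
    then have le: "(4 * (q + 2) * real n ^ q * ln (real n)) * (1 / 2)
        \<le> (4 * (q + 2) * real n ^ q * ln (real n)) * ln 2"
      using n by (intro mult_left_mono) auto
    have eq: "real ((q + 2) * (2 * n ^ q)) * ln (real n)
        = (4 * (q + 2) * real n ^ q * ln (real n)) * (1 / 2)" by (simp add: algebra_simps)
    show ?thesis by (simp only: eq le exp_le_cancel_iff)
  qed
  also have "\<dots> = 2 powr (4 * (q + 2) * real n ^ q * ln (real n))" by (simp add: powr_def)
  finally show ?thesis .
qed

theorem corollary1p4:
  fixes k :: nat
  assumes "k \<ge> 5"
  shows "\<exists>c'::real. c' > 0 \<and>
    (\<forall>n::nat. n \<ge> k \<longrightarrow>
       g_num k n \<le> h_num k 4 n \<and>
       real (h_num k 4 n) \<le> 2 powr (2 powr (2 powr (c' * real n ^ (k - 4) * ln (real n)))))"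
proof -
  define q where "q = k - 4"
  have q: "q \<ge> 1" "k = q + 4" "k - 4 = q" using assms by (auto simp: q_def)
  \<comment> \<open>the power of the greedy size left by the two lowering steps, times the greedy exponent\<close>
  define c :: real where "c = real (4 * q + 14) * (4 * (q + 2))"
  have "g_num k n \<le> h_num k 4 n \<and>
       real (h_num k 4 n) \<le> 2 powr (2 powr (2 powr (c * real n ^ (k - 4) * ln (real n))))"
    if n: "n \<ge> k" for n
  proof
    have "\<exists>N. forces_independent_set k {..4} n N"
      by (rule ex_forces_independent_set) (use assms in auto)
    then have "forces_independent_set k {..4} n (h_num k 4 n)"
      unfolding h_num_def by (rule LeastI_ex)
    then have "forces_independent_set k {0, 2, 4} n (h_num k 4 n)"
      unfolding forces_independent_set_def by fastforce
    then show "g_num k n \<le> h_num k 4 n" unfolding g_num_def by (rule Least_le)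
    define N where "N = (n ^ q + 2) ^ (n + n ^ q)"
    have "2 \<le> n ^ q + 2" by simp
    also have "\<dots> \<le> N" unfolding N_def using n assms by (intro self_le_power) auto
    finally have N2: "2 \<le> N" .
    have "h_num k 4 n \<le> step_down_size (q + 2) (step_down_size (q + 1) N)"
      unfolding h_num_def N_def q(2) by (rule Least_le) (rule forces_independent_set_four)
    also have "\<dots> \<le> 2 ^ (2 ^ (N ^ (4 * q + 14)))" by (rule step_down_size_twice_le[OF N2])
    finally have "real (h_num k 4 n) \<le> real (2 ^ (2 ^ (N ^ (4 * q + 14))))" by (rule of_nat_mono)
    also have "\<dots> = 2 powr (2 powr (real N ^ (4 * q + 14)))"
      by (simp add: powr_realpow[symmetric])
    also have "\<dots> \<le> 2 powr (2 powr (2 powr (c * real n ^ q * ln (real n))))"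
    proof (intro powr_mono)
      have "real N ^ (4 * q + 14) \<le> (2 powr (4 * (q + 2) * real n ^ q * ln (real n))) ^ (4 * q + 14)"
        unfolding N_def by (intro power_mono greedy_size_le) (use n assms q in auto)
      also have "\<dots> = 2 powr (c * real n ^ q * ln (real n))"
        by (simp add: c_def powr_power algebra_simps)
      finally show "real N ^ (4 * q + 14) \<le> 2 powr (c * real n ^ q * ln (real n))" .
    qed auto
    finally show "real (h_num k 4 n) \<le> 2 powr (2 powr (2 powr (c * real n ^ (k - 4) * ln (real n))))"
      using q by simp
  qed
  moreover have "c > 0" by (simp add: c_def)
  ultimately show ?thesis by blast
qed

end
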